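(* (i) Let $\phi\in(0,\pi/2)$ and suppose $\mathrm{spec}(\Lambda_\phi)>0$, i.e. all eigenvalues $\lambda_{\phi1},\dots,\lambda_{\phi d}$ of $\mathbf{M}H_\phi^{-1}\mathbf{N}^{-1}$ are positive. Then for all $t\in[0,\infty)$ $$\Gamma_\phi(t)\in\mathcal{B}_\phi(\mathbf{u}_{\mathrm N},r)\cap\mathcal{B}_\phi(\mathbf{u}_{\mathrm A},r),\qquad r=\|\mathbf{u}_{\mathrm A}-\mathbf{u}_{\mathrm N}\|_{P_\phi}.$$ (ii) Similarly, let $\psi\in(0,\pi/2)$ and suppose $\mathrm{spec}(\Lambda_\psi)>0$, i.e. all eigenvalues $\lambda_{\psi1},\dots,\lambda_{\psi d}$ of $M_1H_\psi^{-1}M_2^{-1}$ are positive. Then for all $t\in[0,\infty)$ $$\Gamma_\psi(t)\in\mathcal{B}_\psi(\mathbf{u}_1,r')\cap\mathcal{B}_\psi(\mathbf{u}_2,r'),\qquad r'=\|\mathbf{u}_1-\mathbf{u}_2\|_{P_\psi}.$$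
   Context: Two-player quadratic game: $d_1,d_2\ge 1$, $d=d_1+d_2$, costs $J_i(u)=\tfrac12u^\top M_iu+c_i^\top u$ for $u=(u_1,u_2)\in\mathbb{R}^{d_1}\times\mathbb{R}^{d_2}$, with symmetric real matrices $$M_1=\begin{bmatrix} A_1 & B_1^\top \\ B_1 & D_1 \end{bmatrix},\quad M_2=\begin{bmatrix} D_2 & B_2 \\ B_2^\top & A_2 \end{bmatrix},\quad c_1=\begin{bmatrix} a_1 \\ b_1 \end{bmatrix},\quad c_2=\begin{bmatrix} b_2 \\ a_2 \end{bmatrix},$$ where $A_1,D_2\in\mathbb{R}^{d_1\times d_1}$, $A_2,D_1\in\mathbb{R}^{d_2\times d_2}$, $B_1\in\mathbb{R}^{d_2\times d_1}$, $B_2\in\mathbb{R}^{d_1\times d_2}$, $a_1,b_2\in\mathbb{R}^{d_1}$, $a_2,b_1\in\mathbb{R}^{d_2}$. Put $$\mathbf{M}=\begin{bmatrix} A_1 & B_2 \\ B_1 & A_2 \end{bmatrix},\quad \mathbf{N}=\begin{bmatrix} D_2 & B_1^\top \\ B_2^\top & D_1 \end{bmatrix},\quad \mathbf{a}=\begin{bmatrix} a_1 \\ a_2 \end{bmatrix},\quad \mathbf{b}=\begin{bmatrix} b_2 \\ b_1 \end{bmatrix}.$$ Standing assumptions: $A_1,A_2\succ0$, and $M_1,M_2,\mathbf{M},\mathbf{N}$ are invertible. Define $\mathbf{u}_{\mathrm N}^\top=-\mathbf{a}^\top\mathbf{M}^{-1}$ (Nash equilibrium), $\mathbf{u}_{\mathrm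 A}^\top=-\mathbf{b}^\top\mathbf{N}^{-1}$ (altruistic Nash), $\mathbf{u}_i^\top=-c_i^\top M_i^{-1}$ (player $i$'s individual optimum). For $\phi,\psi\in(0,\pi/2)$ let $H_\phi=\mathrm{blkdiag}(\cos\phi\, I_{d_1},\sin\phi\, I_{d_2})$ and $H_\psi=\mathrm{blkdiag}(\cos\psi\, I_{d_1},\sin\psi\, I_{d_2})$. The matrices $\mathbf{M}H_\phi^{-1}\mathbf{N}^{-1}$ and $M_1H_\psi^{-1}M_2^{-1}$ are assumed diagonalizable, with eigenvalues $\Lambda_\phi=\{\lambda_{\phi i}\}_{i=1}^d$ and $\Lambda_\psi=\{\lambda_{\psi i}\}_{i=1}^d$, right eigenvectors $V_{\phi i}$ and $V_{\psi i}$, and corresponding left eigenvectors $W_{\phi i}^\top$ and $W_{\psi i}^\top$ (the rows of $V_\phi^{-1}$ and $V_\psi^{-1}$), where $V_\phi=[V_{\phi1}\cdots V_{\phi d}]$ and $V_\psi=[V_{\psi1}\cdots V_{\psi d}]$. Define $$G_\phi(t)=\big[\tfrac1t\mathbf{M}H_\phi^{-1}\mathbf{N}^{-1}+I\big]^{-\top}=\sum_i W_{\phi i}\,\tfrac{t}{\lambda_{\phi i}+t}\,V_{\phi i}^\top,\qquad \Gamma_\phi(t)=\mathbf{u}_{\mathrm N}+G_\phi(t)[\mathbf{u}_{\mathrm A}-\mathbf{u}_{\mathrm N}],$$ $$G_\psi(t)=\big[\tfrac1tM_1H_\psi^{-1}M_2^{-1}+I\big]^{-\top}=\sum_i W_{\psi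 i}\,\tfrac{t}{\lambda_{\psi i}+t}\,V_{\psi i}^\top,\qquad \Gamma_\psi(t)=\mathbf{u}_1+G_\psi(t)[\mathbf{u}_2-\mathbf{u}_1],$$ where at $t=0$ the sum expressions are used. Define the positive definite matrices $P_\phi=V_\phi V_\phi^\top$ and $P_\psi=V_\psi V_\psi^\top$, the norms $\|u\|_{P}=(u^\top Pu)^{1/2}$ for $P=P_\phi,P_\psi$, and the open norm balls with center $c$ and radius $\rho$: $\mathcal{B}_\phi(c,\rho)=\{u\in\mathbb{R}^d:\|u-c\|_{P_\phi}<\rho\}$ and $\mathcal{B}_\psi(c,\rho)=\{u\in\mathbb{R}^d:\|u-c\|_{P_\psi}<\rho\}$.
   Formalization: At t=0 the curve is at u_N (resp. u_1), at distance exactly r (r') from u_A (u_2), and if the endpoints coincide the open balls are empty; so open balls are claimed for distinct endpoints, around u_A (u_2) only for t>0, and closed balls always. *)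

theory Defs
  imports "HOL-Analysis.Analysis"
begin

section \<open>Block vectors and block matrices\<close>

text \<open>
  The decision spaces of the two players are \<open>real ^ 'm\<close> and \<open>real ^ 'n\<close>, so that
  \<open>d\<^sub>1 = CARD('m)\<close> and \<open>d\<^sub>2 = CARD('n)\<close>; the joint space is \<open>real ^ ('m + 'n)\<close>.
  A matrix with \<open>p\<close> rows and \<open>q\<close> columns has type \<open>real ^ 'q ^ 'p\<close>.
\<close>

definition vblock :: "real ^ 'm \<Rightarrow> real ^ 'n \<Rightarrow> real ^ ('m::finite + 'n::finite)" where
  "vblock x y = (\<chi> k. case k of Inl i \<Rightarrow> x $ i | Inr j \<Rightarrow> y $ j)"

definition mblock ::
  "real ^ 'm ^ 'm \<Rightarrow> real ^ 'n ^ 'm \<Rightarrow> real ^ 'm ^ 'n \<Rightarrow> real ^ 'n ^ 'n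
    \<Rightarrow> real ^ ('m::finite + 'n::finite) ^ ('m + 'n)" where
  "mblock P Q R S = (\<chi> k. case k of Inl i \<Rightarrow> vblock (P $ i) (Q $ i)
                                   | Inr j \<Rightarrow> vblock (R $ j) (S $ j))"

definition pos_def :: "real ^ 'k ^ 'k::finite \<Rightarrow> bool" where
  "pos_def P \<longleftrightarrow> transpose P = P \<and> (\<forall>x. x \<noteq> 0 \<longrightarrow> 0 < x \<bullet> (P *v x))"


section \<open>Two-player quadratic games\<close>

record ('m, 'n) game =
  A1 :: "real ^ 'm ^ 'm"
  A2 :: "real ^ 'n ^ 'n"
  B1 :: "real ^ 'm ^ 'n"
  B2 :: "real ^ 'n ^ 'm"
  D1 :: "real ^ 'n ^ 'n"
  D2 :: "real ^ 'm ^ 'm"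
  a1 :: "real ^ 'm"
  a2 :: "real ^ 'n"
  b1 :: "real ^ 'n"
  b2 :: "real ^ 'm"

definition M1 :: "('m::finite, 'n::finite) game \<Rightarrow> real ^ ('m + 'n) ^ ('m + 'n)" where
  "M1 g = mblock (A1 g) (transpose (B1 g)) (B1 g) (D1 g)"

definition M2 :: "('m::finite, 'n::finite) game \<Rightarrow> real ^ ('m + 'n) ^ ('m + 'n)" where
  "M2 g = mblock (D2 g) (B2 g) (transpose (B2 g)) (A2 g)"

definition c1 :: "('m::finite, 'n::finite) game \<Rightarrow> real ^ ('m + 'n)" where
  "c1 g = vblock (a1 g) (b1 g)"

definition c2 :: "('m::finite, 'n::finite) game \<Rightarrow> real ^ ('m + 'n)" where
  "c2 g = vblock (b2 g) (a2 g)"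

definition MM :: "('m::finite, 'n::finite) game \<Rightarrow> real ^ ('m + 'n) ^ ('m + 'n)" where
  "MM g = mblock (A1 g) (B2 g) (B1 g) (A2 g)"

definition NN :: "('m::finite, 'n::finite) game \<Rightarrow> real ^ ('m + 'n) ^ ('m + 'n)" where
  "NN g = mblock (D2 g) (transpose (B1 g)) (transpose (B2 g)) (D1 g)"

definition aa :: "('m::finite, 'n::finite) game \<Rightarrow> real ^ ('m + 'n)" where
  "aa g = vblock (a1 g) (a2 g)"

definition bb :: "('m::finite, 'n::finite) game \<Rightarrow> real ^ ('m + 'n)" where
  "bb g = vblock (b2 g) (b1 g)"

definition standing_assumptions :: "('m::finite, 'n::finite) game \<Rightarrow> bool" where
  "standing_assumptions g \<longleftrightarrow>
     transpose (M1 g) = M1 g \<and> transpose (M2 g) = M2 g \<and>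
     pos_def (A1 g) \<and> pos_def (A2 g) \<and>
     invertible (M1 g) \<and> invertible (M2 g) \<and> invertible (MM g) \<and> invertible (NN g)"

definition u_Nash :: "('m::finite, 'n::finite) game \<Rightarrow> real ^ ('m + 'n)" where
  "u_Nash g = - (aa g v* matrix_inv (MM g))"

definition u_Alt :: "('m::finite, 'n::finite) game \<Rightarrow> real ^ ('m + 'n)" where
  "u_Alt g = - (bb g v* matrix_inv (NN g))"

definition u_opt1 :: "('m::finite, 'n::finite) game \<Rightarrow> real ^ ('m + 'n)" where
  "u_opt1 g = - (c1 g v* matrix_inv (M1 g))"

definition u_opt2 :: "('m::finite, 'n::finite) game \<Rightarrow> real ^ ('m + 'n)" where
  "u_opt2 g = - (c2 g v* matrix_inv (M2 g))"


section \<open>The curves\<close>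

definition H :: "real \<Rightarrow> real ^ ('m::finite + 'n::finite) ^ ('m + 'n)" where
  "H \<theta> = mblock (mat (cos \<theta>)) 0 0 (mat (sin \<theta>))"

definition T_phi :: "('m::finite, 'n::finite) game \<Rightarrow> real \<Rightarrow> real ^ ('m + 'n) ^ ('m + 'n)" where
  "T_phi g \<phi> = MM g ** matrix_inv (H \<phi>) ** matrix_inv (NN g)"

definition T_psi :: "('m::finite, 'n::finite) game \<Rightarrow> real \<Rightarrow> real ^ ('m + 'n) ^ ('m + 'n)" where
  "T_psi g \<psi> = M1 g ** matrix_inv (H \<psi>) ** matrix_inv (M2 g)"

text \<open>
  \<open>diagonalization T lam V\<close>: the columns of the invertible matrix \<open>V\<close> are right eigenvectors
  of \<open>T\<close>, with eigenvalues \<open>lam\<close> listed with multiplicity. The left eigenvectors are the rows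
  of \<open>V\<^sup>-\<^sup>1\<close>. The eigenvectors need not be normalized. Everything is real because
  the eigenvalues of interest are positive and \<open>V V\<^sup>T\<close> has to be positive definite.
\<close>

definition diagonalization ::
  "real ^ 'k ^ 'k \<Rightarrow> ('k \<Rightarrow> real) \<Rightarrow> real ^ 'k ^ 'k::finite \<Rightarrow> bool" where
  "diagonalization T lam V \<longleftrightarrow>
     invertible V \<and> (\<forall>i. T *v column i V = lam i *\<^sub>R column i V)"

definition outer :: "real ^ 'k \<Rightarrow> real ^ 'l \<Rightarrow> real ^ 'l::finite ^ 'k::finite" where
  "outer x y = (\<chi> i j. x $ i * y $ j)"

text \<open>
  The matrix formula for \<open>G(t)\<close> involves \<open>1 / t\<close>; at \<open>t = 0\<close> the spectral sum replaces it.
  The summand is the outer product \<open>W\<^sub>i (t / (lam\<^sub>i + t)) V\<^sub>i\<^sup>T\<close>.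
\<close>

definition G ::
  "real ^ 'k ^ 'k \<Rightarrow> ('k \<Rightarrow> real) \<Rightarrow> real ^ 'k ^ 'k \<Rightarrow> real \<Rightarrow> real ^ 'k ^ 'k::finite" where
  "G T lam V t =
     (if t = 0
      then (\<Sum>i\<in>UNIV. (t / (lam i + t)) *\<^sub>R
              outer (row i (matrix_inv V)) (column i V))
      else transpose (matrix_inv ((1 / t) *\<^sub>R T + mat 1)))"

definition Gamma_phi ::
  "('m::finite, 'n::finite) game \<Rightarrow> real \<Rightarrow> ('m + 'n \<Rightarrow> real) \<Rightarrow> real ^ ('m + 'n) ^ ('m + 'n)
    \<Rightarrow> real \<Rightarrow> real ^ ('m + 'n)" where
  "Gamma_phi g \<phi> lam V t = u_Nash g + G (T_phi g \<phi>) lam V t *v (u_Alt g - u_Nash g)"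

definition Gamma_psi ::
  "('m::finite, 'n::finite) game \<Rightarrow> real \<Rightarrow> ('m + 'n \<Rightarrow> real) \<Rightarrow> real ^ ('m + 'n) ^ ('m + 'n)
    \<Rightarrow> real \<Rightarrow> real ^ ('m + 'n)" where
  "Gamma_psi g \<psi> lam V t = u_opt1 g + G (T_psi g \<psi>) lam V t *v (u_opt2 g - u_opt1 g)"


section \<open>Weighted norm balls\<close>

definition wnorm :: "real ^ 'k ^ 'k::finite \<Rightarrow> real ^ 'k \<Rightarrow> real" where
  "wnorm P u = sqrt (u \<bullet> (P *v u))"

definition wball :: "real ^ 'k ^ 'k::finite \<Rightarrow> real ^ 'k \<Rightarrow> real \<Rightarrow> (real ^ 'k) set" where
  "wball P c \<rho> = {u. wnorm P (u - c) < \<rho>}"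

text \<open>
  The closed balls are needed for the boundary cases: each curve starts at its first endpoint,
  whose distance to the second endpoint is exactly the radius, and all radii vanish when the
  two endpoints coincide.
\<close>

definition wcball :: "real ^ 'k ^ 'k::finite \<Rightarrow> real ^ 'k \<Rightarrow> real \<Rightarrow> (real ^ 'k) set" where
  "wcball P c \<rho> = {u. wnorm P (u - c) \<le> \<rho>}"

end

theory Submission
  imports Defs
begin

text \<open>
  Both curves have the form \<open>u + G(t) (v - u)\<close>, and for both the weight is \<open>P = V V\<^sup>T\<close>, so that
  \<open>\<parallel>w\<parallel>\<^sub>P\<close> is the Euclidean norm of \<open>V\<^sup>T w\<close>. In the coordinates \<open>V\<^sup>T w\<close> the matrix \<open>G(t)\<close> is
  diagonal: it multiplies the coordinate \<open>i\<close> by \<open>\<theta>\<^sub>i = t / (\<lambda>\<^sub>i + t)\<close>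
  (lemma \<open>eigencoordinate_G\<close>). Positive eigenvalues put \<open>\<theta>\<^sub>i\<close> in \<open>[0, 1)\<close>, and in \<open>(0, 1)\<close>
  when \<open>t > 0\<close>. The offset from \<open>u\<close>, which is \<open>G(t) (v - u)\<close>, has coordinates scaled by
  \<open>\<theta>\<^sub>i\<close>; the offset from \<open>v\<close>, which is \<open>(G(t) - I) (v - u)\<close>, has coordinates scaled by
  \<open>\<theta>\<^sub>i - 1\<close>. Scaling every coordinate by a factor of modulus less than one strictly shortens a
  nonzero vector, and this places the curve in both open balls when \<open>u \<noteq> v\<close> and \<open>t > 0\<close>.
  At \<open>t = 0\<close> the factors are \<open>\<theta>\<^sub>i - 1 = -1\<close>, and the distance to \<open>v\<close> equals the radius.

  The two parts are therefore instances of a single statement about a curve that joins \<open>u\<close> to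
  \<open>v\<close> (lemma \<open>interpolating_curve_in_balls\<close>).
\<close>

text \<open>
  Rewriting \<open>V\<^sup>T w\<close> to \<open>w v* V\<close> would hide the eigencoordinates from the lemmas about them.
\<close>
declare transpose_matrix_vector [simp del]

lemma norm_diagonal_scaling_le:
  fixes x y :: "real ^ 'k::finite"
  assumes "\<And>i. x $ i = s i * y $ i" and "\<And>i. \<bar>s i\<bar> \<le> 1"
  shows "norm x \<le> norm y"
  by (rule norm_le_componentwise_cart) (simp add: assms abs_mult mult_left_le_one_le)

lemma norm_diagonal_scaling_less:
  fixes x y :: "real ^ 'k::finite"
  assumes x: "\<And>i. x $ i = s i * y $ i" and s: "\<And>i. \<bar>s i\<bar> < 1" and "y \<noteq> 0"
  shows "norm x < norm y"
proof -
  obtain k where k: "y $ k \<noteq> 0"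
    using \<open>y \<noteq> 0\<close> by (auto simp: vec_eq_iff)
  have "(x $ i)\<^sup>2 \<le> (y $ i)\<^sup>2" for i
    using s[of i] by (simp add: x abs_mult mult_left_le_one_le flip: abs_le_square_iff)
  moreover have "(x $ k)\<^sup>2 < (y $ k)\<^sup>2"
    using s[of k] k by (simp add: x power_mult_distrib abs_square_less_1)
  ultimately have "(\<Sum>i\<in>UNIV. (x $ i)\<^sup>2) < (\<Sum>i\<in>UNIV. (y $ i)\<^sup>2)"
    by (intro sum_strict_mono_ex1) auto
  then show ?thesis
    by (simp add: norm_eq_sqrt_inner inner_vec_def power2_eq_square)
qed

lemma wnorm_gram:
  "wnorm (V ** transpose V) u = norm (transpose V *v u)"
  by (simp add: wnorm_def norm_eq_sqrt_inner dot_lmul_matrix transpose_matrix_vector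
      flip: matrix_vector_mul_assoc)

lemma wnorm_minus_commute:
  "wnorm P (u - v) = wnorm P (v - u)"
proof -
  have "u - v = - (v - u)"
    by simp
  then show ?thesis
    unfolding wnorm_def
    by (simp only: linear_neg[OF matrix_vector_mul_linear] inner_minus_left inner_minus_right minus_minus)
qed

lemma transpose_mult_component:
  fixes V :: "real ^ 'n ^ 'm"
  shows "(transpose V *v u) $ i = column i V \<bullet> u"
  by (simp add: matrix_vector_mult_def transpose_def column_def inner_vec_def)

text \<open>
  The columns of an invertible \<open>V\<close> form a basis, and only the zero vector is orthogonal to a
  basis. This is why the eigencoordinates \<open>V\<^sup>T u\<close> determine \<open>u\<close>.
\<close>
lemma transpose_mult_eq_0_iff:
  fixes V :: "real ^ 'k::finite ^ 'k"
  assumes "invertible V"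
  shows "transpose V *v u = 0 \<longleftrightarrow> u = 0"
  using transpose_invertible[OF assms] unfolding invertible_left_inverse matrix_left_invertible_ker
  by (metis matrix_vector_mult_0_right)

text \<open>
  For \<open>t > 0\<close> put \<open>S = T / t + I\<close>. Its eigenvectors are those of \<open>T\<close>, with eigenvalues
  \<open>\<lambda>\<^sub>i / t + 1 > 0\<close>. Pairing with an eigenvector therefore turns \<open>S\<^sup>T\<close> into multiplication by
  \<open>\<lambda>\<^sub>i / t + 1\<close>, which shows both that \<open>S\<^sup>T\<close> has trivial kernel and that its inverse, which is
  \<open>G(t)\<close>, divides by this factor.
\<close>
lemma eigencoordinate_G:
  fixes T V :: "real ^ 'k::finite ^ 'k"
  assumes diag: "diagonalization T lam V" and pos: "\<And>i. 0 < lam i" and t: "0 \<le> t"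
  shows "(transpose V *v (G T lam V t *v w)) $ i = t / (lam i + t) * (transpose V *v w) $ i"
proof (cases "t = 0")
  case True
  then show ?thesis
    by (simp add: G_def)
next
  case False
  with t have "0 < t"
    by simp
  define S where "S = (1 / t) *\<^sub>R T + mat 1"
  have S_column: "S *v column i V = (lam i / t + 1) *\<^sub>R column i V" for i
    using diag by (simp add: S_def diagonalization_def matrix_vector_mult_add_rdistrib
        scaleR_matrix_vector_assoc[symmetric] scaleR_add_left)
  have coord: "(transpose V *v (transpose S *v y)) $ i = (lam i / t + 1) * (transpose V *v y) $ i"
    for y i
    unfolding transpose_mult_component
    by (metis S_column dot_lmul_matrix inner_scaleR_left transpose_matrix_vector
        transpose_transpose)
  have factor: "lam i / t + 1 > 0" for i
    using pos[of i] \<open>0 < t\<close> by (simp add: add_pos_pos)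
  have "y = 0" if "transpose S *v y = 0" for y
  proof -
    have "transpose V *v y = 0"
    proof (rule vec_eq_iff[THEN iffD2], rule)
      show "(transpose V *v y) $ i = 0 $ i" for i
        using coord[of y i] factor[of i] unfolding that by simp
    qed
    then show ?thesis
      using diag by (simp add: diagonalization_def transpose_mult_eq_0_iff)
  qed
  then have "invertible (transpose S)"
    by (simp add: invertible_left_inverse matrix_left_invertible_ker)
  then have "invertible S"
    using transpose_invertible by fastforce
  then have "matrix_inv S ** S = mat 1"
    unfolding invertible_def matrix_inv_def by (rule someI2_ex) simp
  then have "transpose S ** transpose (matrix_inv S) = mat 1"
    by (metis matrix_transpose_mul transpose_mat)
  then have "transpose S *v (G T lam V t *v w) = w"
    using False by (simp add: G_def S_def matrix_vector_mul_assoc)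
  then have "(transpose V *v w) $ i = (lam i / t + 1) * (transpose V *v (G T lam V t *v w)) $ i"
    using coord[of "G T lam V t *v w" i] by simp
  moreover have "lam i + t > 0"
    using pos[of i] t by simp
  ultimately show ?thesis
    using \<open>0 < t\<close> by (simp add: field_simps)
qed

lemma interpolating_curve_in_balls:
  fixes T V :: "real ^ 'k::finite ^ 'k"
  defines "P \<equiv> V ** transpose V"
  assumes diag: "diagonalization T lam V" and pos: "\<And>i. 0 < lam i" and t: "0 \<le> t"
  shows curve_in_cballs:
      "u + G T lam V t *v (v - u) \<in> wcball P u (wnorm P (v - u)) \<inter> wcball P v (wnorm P (v - u))"
    and curve_in_start_ball:
      "u \<noteq> v \<Longrightarrow> u + G T lam V t *v (v - u) \<in> wball P u (wnorm P (v - u))"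
    and curve_in_end_ball:
      "u \<noteq> v \<Longrightarrow> 0 < t \<Longrightarrow> u + G T lam V t *v (v - u) \<in> wball P v (wnorm P (v - u))"
proof -
  define \<theta> where "\<theta> i = t / (lam i + t)" for i
  define y where "y = transpose V *v (v - u)"
  have \<theta>: "0 \<le> \<theta> i" "\<theta> i < 1" "0 < t \<Longrightarrow> 0 < \<theta> i" for i
    using pos[of i] t by (simp_all add: \<theta>_def)
  have from_start: "(transpose V *v (u + G T lam V t *v (v - u) - u)) $ i = \<theta> i * y $ i" for i
    using eigencoordinate_G[OF diag pos t] by (simp add: \<theta>_def y_def)
  have "u + G T lam V t *v (v - u) - v = G T lam V t *v (v - u) - (v - u)"
    by simp
  then have from_end:
    "(transpose V *v (u + G T lam V t *v (v - u) - v)) $ i = (\<theta> i - 1) * y $ i" for i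
    using eigencoordinate_G[OF diag pos t]
    by (simp only: matrix_vector_mult_diff_distrib[of "transpose V" _ "v - u"])
      (simp add: \<theta>_def y_def left_diff_distrib)
  have y: "y \<noteq> 0" if "u \<noteq> v"
    using that diag by (simp add: y_def diagonalization_def transpose_mult_eq_0_iff)
  note wnorm = P_def wnorm_gram y_def[symmetric]
  have abs_le: "\<bar>\<theta> i\<bar> \<le> 1" "\<bar>\<theta> i - 1\<bar> \<le> 1" for i
    using \<theta>(1,2)[of i] by linarith+
  show "u + G T lam V t *v (v - u) \<in> wcball P u (wnorm P (v - u)) \<inter> wcball P v (wnorm P (v - u))"
    unfolding wcball_def wnorm
    using norm_diagonal_scaling_le[OF from_start abs_le(1)]
      norm_diagonal_scaling_le[OF from_end abs_le(2)]
    by blast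
  show "u + G T lam V t *v (v - u) \<in> wball P u (wnorm P (v - u))" if "u \<noteq> v"
  proof -
    have "\<bar>\<theta> i\<bar> < 1" for i
      using \<theta>(1,2)[of i] by linarith
    from norm_diagonal_scaling_less[OF from_start this y[OF that]] show ?thesis
      unfolding wball_def wnorm by blast
  qed
  show "u + G T lam V t *v (v - u) \<in> wball P v (wnorm P (v - u))" if "u \<noteq> v" "0 < t"
  proof -
    have "\<bar>\<theta> i - 1\<bar> < 1" for i
      using \<theta>(2)[of i] \<theta>(3)[OF that(2), of i] by linarith
    from norm_diagonal_scaling_less[OF from_end this y[OF that(1)]] show ?thesis
      unfolding wball_def wnorm by blast
  qed
qed

theorem proposition4:
  fixes g :: "('m::finite, 'n::finite) game"
  assumes "standing_assumptions g"
  shows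
    "(\<forall>\<phi> lam V.
        \<phi> \<in> {0<..<pi/2} \<and> diagonalization (T_phi g \<phi>) lam V \<and> (\<forall>i. 0 < lam i) \<longrightarrow>
        (let P = V ** transpose V;
             r = wnorm P (u_Alt g - u_Nash g)
         in (u_Alt g \<noteq> u_Nash g \<longrightarrow>
               (\<forall>t\<in>{0<..}. Gamma_phi g \<phi> lam V t \<in> wball P (u_Nash g) r \<inter> wball P (u_Alt g) r) \<and>
               Gamma_phi g \<phi> lam V 0 \<in> wball P (u_Nash g) r) \<and>
            (\<forall>t\<in>{0..}. Gamma_phi g \<phi> lam V t \<in> wcball P (u_Nash g) r \<inter> wcball P (u_Alt g) r)))
     \<and>
     (\<forall>\<psi> lam V.
        \<psi> \<in> {0<..<pi/2} \<and> diagonalization (T_psi g \<psi>) lam V \<and> (\<forall>i. 0 < lam i) \<longrightarrow>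
        (let P = V ** transpose V;
             r' = wnorm P (u_opt1 g - u_opt2 g)
         in (u_opt1 g \<noteq> u_opt2 g \<longrightarrow>
               (\<forall>t\<in>{0<..}. Gamma_psi g \<psi> lam V t \<in> wball P (u_opt1 g) r' \<inter> wball P (u_opt2 g) r') \<and>
               Gamma_psi g \<psi> lam V 0 \<in> wball P (u_opt1 g) r') \<and>
            (\<forall>t\<in>{0..}. Gamma_psi g \<psi> lam V t \<in> wcball P (u_opt1 g) r' \<inter> wcball P (u_opt2 g) r')))"
  \<comment> \<open>The second radius is measured from the end point of the curve to its start, hence the swap.\<close>
  unfolding Let_def Gamma_phi_def Gamma_psi_def wnorm_minus_commute[of _ "u_opt1 g" "u_opt2 g"]
  by (intro conjI allI impI ballI IntI; elim conjE;
      (rule curve_in_start_ball | rule curve_in_end_ball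
        | rule curve_in_cballs[THEN IntD1] | rule curve_in_cballs[THEN IntD2]); force)

end
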